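(* Let $r\ge0$ be an integer, let $\alpha\in\mathbb C$, let $F\in\mathbb C[[z]]$ be Möbius-covariant of weight $\alpha$, and put $q:=r-1-\alpha$, $\sigma(z):=-\frac{z}{1-z}$. Suppose that $U(z)\in z\,\mathbb C[[z]]$ and $A(z)\in\mathbb C[[z]]$ satisfy $$U(\sigma(z))=-U(z),\qquad (1-z)^qA(\sigma(z))=A(z).$$ Then, for every $G(t)\in\mathbb C[[t]]$, $$[z^r]\,A(z)\,G(U(z))\,F(z)=[z^r]\,A(-z)\,G(-U(-z))\,F(-z).$$ Moreover, if for integers $j\ge0$ $$K_{r,j}(F;A,U):=[z^r]\,A(z)\,U(z)^j\,F(z),$$ then $K_{r,j}(F;A,U)=0$ whenever $r+j$ is odd.
   Context: $[z^r]H(z)$ denotes the coefficient of $z^r$ in the formal power series $H(z)$. For $\beta\in\mathbb C$, $(1-z)^\beta:=\sum_{k\ge0}\binom{\beta}{k}(-z)^k$. A series $F\in\mathbb C[[z]]$ is Möbius-covariant of weight $\alpha$ if $F\!\left(-\frac{z}{1-z}\right)=(1-z)^{-\alpha}F(z)$ in $\mathbb C[[z]]$. *)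

theory Defs
  imports Complex_Main "HOL-Computational_Algebra.Formal_Power_Series"
begin

text \<open>The formal power series \<open>(1 - z)\<^sup>\<beta>\<close> for an arbitrary complex exponent.\<close>

definition one_minus_pow :: "complex \<Rightarrow> complex fps" where
  "one_minus_pow \<beta> = Abs_fps (\<lambda>k. (\<beta> gchoose k) * (- 1) ^ k)"

definition moebius_sigma :: "complex fps" where
  "moebius_sigma = - (fps_X / (1 - fps_X))"

text \<open>
  The library composition \<open>oo\<close> is the usual substitution of formal power series only if
  its second argument has constant term 0; this holds for \<^const>\<open>moebius_sigma\<close>.
\<close>

definition moebius_covariant :: "complex \<Rightarrow> complex fps \<Rightarrow> bool" where
  "moebius_covariant \<alpha> F \<longleftrightarrow> F oo moebius_sigma = one_minus_pow (- \<alpha>) * F"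

definition K_coeff ::
  "nat \<Rightarrow> nat \<Rightarrow> complex fps \<Rightarrow> complex fps \<Rightarrow> complex fps \<Rightarrow> complex" where
  "K_coeff r j F A U = fps_nth (A * U ^ j * F) r"

end

theory Submission
  imports Defs
begin

text \<open>
  Substituting \<open>\<sigma>\<close> into \<open>H = A \<cdot> G(U) \<cdot> F\<close> and multiplying by \<open>(1 - z)\<^bsup>r-1\<^esup>\<close> replaces \<open>U\<close> by
  \<open>- U\<close>. On the other hand this operation acts on the coefficient of \<open>z\<^sup>r\<close> as the sign \<open>(-1)\<^sup>r\<close>,
  because it maps \<open>z\<^sup>k\<close> to \<open>(-z)\<^sup>k (1 - z)\<^bsup>r-1-k\<^esup>\<close>, which for \<open>k < r\<close> is a polynomial of degree
  at most \<open>r - 1\<close>.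
\<close>

text \<open>Substituting \<open>- fps_X\<close> is a ring homomorphism, so this carries the exponent
  laws of \<open>fps_binomial\<close> over.\<close>

lemma one_minus_pow_eq_compose: "one_minus_pow \<beta> = fps_binomial \<beta> oo (- fps_X)"
  by (simp add: one_minus_pow_def fps_binomial_def fps_compose_uminus' mult.commute)

lemma one_minus_pow_add: "one_minus_pow (a + b) = one_minus_pow a * one_minus_pow b"
  by (simp add: one_minus_pow_eq_compose fps_binomial_add_mult fps_compose_mult_distrib)

lemma one_minus_pow_0 [simp]: "one_minus_pow 0 = 1"
  by (simp add: one_minus_pow_eq_compose)

lemma one_minus_pow_1: "one_minus_pow 1 = 1 - fps_X"
  by (simp add: one_minus_pow_eq_compose fps_binomial_1 fps_compose_add_distrib)

text \<open>In this form powers of \<sigma> combine with the other powers of 1 - z by adding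
  exponents.\<close>

lemma moebius_sigma_eq: "moebius_sigma = (- fps_X) * one_minus_pow (- 1)"
proof -
  have "one_minus_pow (- 1) * (1 - fps_X) = 1"
    using one_minus_pow_add[of "-1" 1] by (simp add: one_minus_pow_1)
  then have "inverse (1 - fps_X) = one_minus_pow (- 1)"
    by (metis fps_inverse_unique mult.commute)
  then show ?thesis
    by (simp add: moebius_sigma_def fps_divide_unit)
qed

lemma moebius_sigma_nth_0 [simp]: "fps_nth moebius_sigma 0 = 0"
  by (simp add: moebius_sigma_eq)

lemma moebius_sigma_power:
  "moebius_sigma ^ k = (- fps_X) ^ k * one_minus_pow (- of_nat k)"
proof (induction k)
  case (Suc k)
  have "one_minus_pow (- of_nat (Suc k)) = one_minus_pow (- 1) * one_minus_pow (- of_nat k)"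
    by (simp flip: one_minus_pow_add)
  with Suc show ?case
    by (simp add: moebius_sigma_eq mult_ac)
qed simp

lemma fps_nth_mult_compose:
  fixes P H S :: "'a::comm_ring_1 fps"
  assumes "fps_nth S 0 = 0"
  shows "fps_nth (P * (H oo S)) n = (\<Sum>k\<le>n. fps_nth H k * fps_nth (P * S ^ k) n)"
proof -
  \<comment> \<open>\<open>S ^ k\<close> has no terms below degree k, so one range k \<le> n serves
    every m \<le> n; the two sums can then be swapped.\<close>
  have "fps_nth (H oo S) m = (\<Sum>k\<le>n. fps_nth H k * fps_nth (S ^ k) m)" if "m \<le> n" for m
    unfolding fps_compose_nth
    using that assms by (intro sum.mono_neutral_left) (auto simp: startsby_zero_power_prefix)
  then have "fps_nth (P * (H oo S)) n =
      (\<Sum>i=0..n. \<Sum>k\<le>n. fps_nth H k * (fps_nth P i * fps_nth (S ^ k) (n - i)))"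
    by (simp add: fps_mult_nth sum_distrib_left mult_ac)
  also have "\<dots> = (\<Sum>k\<le>n. fps_nth H k * fps_nth (P * S ^ k) n)"
    by (subst sum.swap) (simp add: fps_mult_nth sum_distrib_left)
  finally show ?thesis .
qed

lemma fps_nth_one_minus_pow_mult_sigma_power:
  assumes "k \<le> r"
  shows "fps_nth (one_minus_pow (of_nat r - 1) * moebius_sigma ^ k) r =
    (if k = r then (- 1) ^ r else 0)"
proof -
  have "one_minus_pow (of_nat r - 1) * moebius_sigma ^ k =
      (- fps_X) ^ k * one_minus_pow (of_nat r - 1 - of_nat k)"
    using one_minus_pow_add[of "of_nat r - 1" "- of_nat k"]
    by (simp add: moebius_sigma_power mult_ac)
  also have "\<dots> = fps_const ((- 1) ^ k) * (fps_X ^ k * one_minus_pow (of_nat r - 1 - of_nat k))"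
    by (cases "even k") (simp_all flip: fps_const_neg)
  finally have *: "fps_nth (one_minus_pow (of_nat r - 1) * moebius_sigma ^ k) r =
      (- 1) ^ k * fps_nth (one_minus_pow (of_nat r - 1 - of_nat k)) (r - k)"
    using assms by (simp add: fps_X_power_mult_nth)
  show ?thesis
  proof (cases "k = r")
    case True
    with * show ?thesis by (simp add: one_minus_pow_def)
  next
    case False
    with assms obtain n where n: "r = k + Suc n"
      by (metis add_Suc_right le_neq_implies_less less_imp_Suc_add)
    \<comment> \<open>The exponent is the natural number n, while the coefficient wanted has index r
      - k = n + 1, just above the degree.\<close>
    have "of_nat r - 1 - of_nat k = (of_nat n :: complex)"
      by (simp add: n)
    moreover have "(of_nat n :: complex) gchoose Suc n = 0"
      by (simp flip: binomial_gbinomial)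
    ultimately show ?thesis
      using * False n by (simp add: one_minus_pow_def)
  qed
qed

lemma fps_nth_one_minus_pow_mult_compose_sigma:
  "fps_nth (one_minus_pow (of_nat r - 1) * (H oo moebius_sigma)) r = (- 1) ^ r * fps_nth H r"
proof -
  have "fps_nth (one_minus_pow (of_nat r - 1) * (H oo moebius_sigma)) r =
      (\<Sum>k\<le>r. fps_nth H k * (if k = r then (- 1) ^ r else 0))"
    by (simp add: fps_nth_mult_compose fps_nth_one_minus_pow_mult_sigma_power)
  also have "\<dots> = (\<Sum>k\<le>r. if k = r then fps_nth H k * (- 1) ^ r else 0)"
    by (intro sum.cong) auto
  finally show ?thesis
    by (simp add: mult.commute)
qed

text \<open>Since q + \<alpha> = r - 1, the factor (1 - z)^(r-1) splits into the weights that
  restore \<open>A\<close> and \<open>F\<close> after substituting \<sigma>; only the sign of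
  \<open>U\<close> changes.\<close>

lemma fps_nth_covariant_product_reflect:
  assumes F: "moebius_covariant \<alpha> F"
    and q: "q = of_nat r - 1 - \<alpha>"
    and U0: "fps_nth U 0 = 0"
    and U: "U oo moebius_sigma = - U"
    and A: "one_minus_pow q * (A oo moebius_sigma) = A"
  shows "fps_nth (A * (G oo (- U)) * F) r = (- 1) ^ r * fps_nth (A * (G oo U) * F) r"
proof -
  have F': "one_minus_pow \<alpha> * (F oo moebius_sigma) = F"
    using F one_minus_pow_add[of \<alpha> "- \<alpha>"]
    by (simp add: moebius_covariant_def flip: mult.assoc)
  have G: "(G oo U) oo moebius_sigma = G oo (- U)"
    using U0 by (simp add: U flip: fps_compose_assoc)
  have "one_minus_pow (of_nat r - 1) = one_minus_pow q * one_minus_pow \<alpha>"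
    by (simp add: q flip: one_minus_pow_add)
  then have "one_minus_pow (of_nat r - 1) * ((A * (G oo U) * F) oo moebius_sigma) =
      (one_minus_pow q * (A oo moebius_sigma)) * (G oo (- U)) *
      (one_minus_pow \<alpha> * (F oo moebius_sigma))"
    by (simp add: fps_compose_mult_distrib G mult_ac)
  also have "\<dots> = A * (G oo (- U)) * F"
    by (simp only: A F')
  finally show ?thesis
    by (metis fps_nth_one_minus_pow_mult_compose_sigma)
qed

theorem proposition2p9:
  fixes r :: nat and \<alpha> q :: complex and F U A :: "complex fps"
  assumes "moebius_covariant \<alpha> F"
    and "q = of_nat r - 1 - \<alpha>"
    and "fps_nth U 0 = 0"
    and "U oo moebius_sigma = - U"
    and "one_minus_pow q * (A oo moebius_sigma) = A"
  shows "(\<forall>G :: complex fps.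
            fps_nth (A * (G oo U) * F) r =
            fps_nth ((A oo (- fps_X)) * (G oo (- (U oo (- fps_X)))) * (F oo (- fps_X))) r)
         \<and> (\<forall>j :: nat. odd (r + j) \<longrightarrow> K_coeff r j F A U = 0)"
proof (intro conjI allI impI)
  note reflect = fps_nth_covariant_product_reflect[OF assms]
  fix G :: "complex fps"
  have "G oo (- (U oo (- fps_X))) = (G oo (- U)) oo (- fps_X)"
    using assms(3) by (simp add: fps_compose_uminus flip: fps_compose_assoc)
  then have "(A oo (- fps_X)) * (G oo (- (U oo (- fps_X)))) * (F oo (- fps_X)) =
      (A * (G oo (- U)) * F) oo (- fps_X)"
    by (simp add: fps_compose_mult_distrib)
  \<comment> \<open>Replacing z by -z contributes a second sign (-1)^r, which cancels the one from
    \<open>reflect\<close>.\<close>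
  then show "fps_nth (A * (G oo U) * F) r =
      fps_nth ((A oo (- fps_X)) * (G oo (- (U oo (- fps_X)))) * (F oo (- fps_X))) r"
    by (simp add: fps_compose_uminus' reflect flip: power_mult_distrib mult.assoc)
next
  fix j :: nat
  assume j: "odd (r + j)"
  \<comment> \<open>Take G = t^j. The left side is (-1)^j times the coefficient on the right, so
    opposite parities of r and j make that coefficient its own negative.\<close>
  have "fps_nth (A * (- U) ^ j * F) r = (- 1) ^ r * fps_nth (A * U ^ j * F) r"
    using fps_nth_covariant_product_reflect[OF assms, of "fps_X ^ j"] assms(3)
    by (simp add: fps_X_power_compose)
  then show "K_coeff r j F A U = 0"
    using j by (cases "even r") (auto simp: K_coeff_def)
qed

end
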